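(* For all $3\le k\le n-1$, \[ g^{\mathrm r}_n(1k)=\sum_{i=1}^{k-1}\alpha_{k,i}\,b^{\mathrm r}_i\,g^{\mathrm r}_{n-i}, \] where $\alpha_{k,i}=\binom{k-1}{i-1}-\binom{k-3}{i-3}$ and $b^{\mathrm r}_i=-\theta^{(i-1)/2}U_{i+1}\bigl(\sqrt\theta/2\bigr)$.
   Context: $\mathcal S_n$ is the set of permutations of $[n]$. For $\pi\in\mathcal S_n$ written in standard cycle form (each cycle begins with its smallest element, cycles ordered left to right by increasing smallest elements), $\mathrm{Flatten}(\pi)$ is the word obtained by erasing the parentheses. For a word $w$, $\mathrm r(w)$ is the number of indices $i$ with $w_i<w_{i+1}<w_{i+2}$ (occurrences of $123$-subwords). For letters $a_1,\dots,a_k$, $g^{\mathrm r}_n(a_1\cdots a_k)=\sum_\pi q^{\mathrm r(\mathrm{Flatten}(\pi))}$ over $\pi\in\mathcal S_n$ with $\mathrm{Flatten}(\pi)$ beginning with $a_1\cdots a_k$, and $g^{\mathrm r}_n=g^{\mathrm r}_n(1)=\sum_{\pi\in\mathcal S_n}q^{\mathrm r(\mathrm{Flatten}(\pi))}$. Here $q$ is an indeterminate and $\theta=1-q$. Binomial coefficients $\binom{a}{b}$ with $b<0$ are $0$. $U_m$ are the Chebyshev polynomials of the second kind: $U_{-2}(t)=-1$, $U_{-1}(t)=0$, $U_m(t)=2tU_{m-1}(t)-U_{m-2}(t)$ for $m\ge0$. *)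

theory Defs
  imports
    "HOL-Combinatorics.Combinatorics"
    "HOL-Computational_Algebra.Polynomial"
    "HOL-Library.Sublist"
begin

text \<open>The library's \<open>support \<pi> x\<close> is the list \<open>[x, \<pi> x, \<pi> (\<pi> x), ...]\<close> running once through
  the cycle of \<open>x\<close>; it has length 1 for a fixed point.\<close>

definition standard_cycle_form :: "nat \<Rightarrow> (nat \<Rightarrow> nat) \<Rightarrow> nat list list" where
  "standard_cycle_form n \<pi> =
     map (support \<pi>) (filter (\<lambda>x. \<forall>y\<in>set (support \<pi> x). x \<le> y) [1..<Suc n])"

definition flatten :: "nat \<Rightarrow> (nat \<Rightarrow> nat) \<Rightarrow> nat list" where
  "flatten n \<pi> = concat (standard_cycle_form n \<pi>)"

definition r123 :: "nat list \<Rightarrow> nat" where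
  "r123 w = card {i. i + 2 < length w \<and> w ! i < w ! (i + 1) \<and> w ! (i + 1) < w ! (i + 2)}"

text \<open>The generating functions are polynomials in the indeterminate \<open>q\<close>, which is \<open>[:0, 1:]\<close>.\<close>

definition gr_word :: "nat \<Rightarrow> nat list \<Rightarrow> rat poly" where
  "gr_word n u =
     (\<Sum>\<pi> | \<pi> permutes {1..n} \<and> prefix u (flatten n \<pi>). [:0, 1:] ^ r123 (flatten n \<pi>))"

definition gr :: "nat \<Rightarrow> rat poly" where
  "gr n = (\<Sum>\<pi> | \<pi> permutes {1..n}. [:0, 1:] ^ r123 (flatten n \<pi>))"

lemma gr_eq_gr_word:
  assumes "n \<ge> 1"
  shows "gr n = gr_word n [1]"
proof -
  have "prefix [1] (flatten n \<pi>)" if p: "\<pi> permutes {1..n}" for \<pi>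
  proof -
    have perm: "permutation \<pi>"
      using p permutation_permutes by blast
    have pos: "least_power \<pi> 1 > 0"
      using least_power_of_permutation(2)[OF perm] .
    have orbit_in: "(\<pi> ^^ i) 1 \<in> {1..n}" for i
    proof (induction i)
      case 0
      show ?case
        using assms by simp
    next
      case (Suc i)
      then show ?case
        using permutes_in_image[OF p] by (metis comp_apply funpow.simps(2))
    qed
    have min1: "\<forall>y\<in>set (support \<pi> 1). 1 \<le> y"
      using orbit_in by auto
    have "[1..<Suc n] = 1 # [2..<Suc n]"
      using assms by (simp add: upt_conv_Cons numeral_2_eq_2)
    then have "flatten n \<pi> = support \<pi> 1 @
        concat (map (support \<pi>) (filter (\<lambda>x. \<forall>y\<in>set (support \<pi> x). x \<le> y) [2..<Suc n]))"
      using min1 by (simp add: flatten_def standard_cycle_form_def)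
    moreover have "support \<pi> 1 = 1 # map (\<lambda>i. (\<pi> ^^ i) 1) [1..<least_power \<pi> 1]"
      using pos by (simp add: upt_conv_Cons)
    ultimately show ?thesis
      by simp
  qed
  then have "{\<pi>. \<pi> permutes {1..n} \<and> prefix [1] (flatten n \<pi>)} = {\<pi>. \<pi> permutes {1..n}}"
    by blast
  then show ?thesis
    by (simp only: gr_def gr_word_def)
qed

text \<open>The square root of \<open>\<theta> = 1 - q\<close> is adjoined formally: the extension of \<open>\<rat>[q]\<close> by a
  square root \<open>s\<close> of \<open>1 - q\<close> is \<open>\<rat>[s]\<close>, into which \<open>\<rat>[q]\<close> embeds by \<open>q \<mapsto> 1 - s\<^sup>2\<close>.
  Below, \<open>sqrt_theta\<close> is the indeterminate \<open>s\<close> and \<open>adjoin_sqrt\<close> is this embedding.\<close>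

definition sqrt_theta :: "rat poly" where
  "sqrt_theta = [:0, 1:]"

definition adjoin_sqrt :: "rat poly \<Rightarrow> rat poly" where
  "adjoin_sqrt p = pcompose p (1 - sqrt_theta ^ 2)"

lemma inj_adjoin_sqrt: "inj adjoin_sqrt"
proof (rule injI)
  fix p p' :: "rat poly"
  assume "adjoin_sqrt p = adjoin_sqrt p'"
  then have "pcompose (p - p') (1 - sqrt_theta ^ 2) = 0"
    by (simp add: adjoin_sqrt_def pcompose_diff)
  moreover have "degree (1 - sqrt_theta ^ 2) > 0"
    by (simp add: sqrt_theta_def power2_eq_square one_pCons)
  ultimately have "p - p' = 0"
    using pcompose_eq_0 by blast
  then show "p = p'"
    by simp
qed

lemma sqrt_theta_squared: "sqrt_theta ^ 2 = adjoin_sqrt (1 - [:0, 1:])"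
  by (simp add: adjoin_sqrt_def pcompose_diff pcompose_pCons pcompose_1)

text \<open>Chebyshev polynomials of the second kind, indexed from \<open>-2\<close>; values below \<open>-2\<close> are irrelevant.\<close>

function cheb_U :: "int \<Rightarrow> 'a::comm_ring_1 \<Rightarrow> 'a" where
  "cheb_U m t =
     (if m \<le> -2 then -1
      else if m = -1 then 0
      else 2 * t * cheb_U (m - 1) t - cheb_U (m - 2) t)"
  by auto
termination
  by (relation "Wellfounded.measure (\<lambda>(m, t). nat (m + 2))") auto

declare cheb_U.simps [simp del]

text \<open>Here \<open>\<theta>\<close> to the power \<open>(i - 1)/2\<close> is the power \<open>i - 1\<close> of \<open>sqrt_theta\<close>, for \<open>i \<ge> 1\<close>.\<close>

definition br :: "nat \<Rightarrow> rat poly" where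
  "br i = - (sqrt_theta ^ (i - 1) * cheb_U (int i + 1) (smult (1/2) sqrt_theta))"

definition binom :: "nat \<Rightarrow> int \<Rightarrow> int" where
  "binom m j = (if j < 0 then 0 else int (m choose nat j))"

definition alpha :: "nat \<Rightarrow> nat \<Rightarrow> int" where
  "alpha k i = binom (k - 1) (int i - 1) - binom (k - 3) (int i - 3)"

end

theory Submission
  imports Defs
begin

text \<open>In the standard cycle form the cycles open at right-to-left minima of the flattened word, and
  each right-to-left minimum other than the initial \<open>1\<close> is free to open a cycle or not. So
  \<open>gr\<close> sums \<open>2\<^sup>m q\<^sup>r\<close> over the words \<open>w\<close> that permute \<open>[n]\<close> and begin with \<open>1\<close>, where \<open>r\<close> counts
  the \<open>123\<close>-subwords of \<open>w\<close> and \<open>m\<close> its right-to-left minima apart from \<open>1\<close>.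

  Reading a word from left to right, the weight of all continuations depends only on the rank of
  the current letter among the remaining ones and on the direction of the last step. Eliminating
  the descent case from this transfer recursion shows that \<open>B n m = gr_word (n + 2) [1, m + 2]\<close>
  has, for \<open>1 \<le> m \<le> n\<close>, second difference in \<open>m\<close>
  \<open>B (n + 2) (m + 2) - 2 B (n + 2) (m + 1) + B (n + 2) m
    = \<theta> (B (n + 1) (m + 1) - B (n + 1) m - B n m)\<close>.
  The right-hand side of the theorem satisfies the same relation, by Pascal's rule for \<open>\<alpha>\<close> and the
  Chebyshev recurrence \<open>b (i + 2) = \<theta> (b (i + 1) - b i)\<close>; both sides agree for \<open>k = 3\<close> and
  \<open>k = 4\<close>.\<close>

subsection \<open>Permutations with a given flattened word\<close>

fun rlmin :: "nat list \<Rightarrow> nat" where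
  "rlmin [] = 0"
| "rlmin (x # xs) = (if \<forall>y\<in>set xs. x < y then Suc (rlmin xs) else rlmin xs)"

text \<open>Comparing a head with all letters to its right imposes both demands of standard cycle
  form at once: cycles start with their least letter, and these letters increase.\<close>

fun led_by_minima :: "nat list list \<Rightarrow> bool" where
  "led_by_minima [] \<longleftrightarrow> True"
| "led_by_minima (c # cs) \<longleftrightarrow>
     c \<noteq> [] \<and> (\<forall>y\<in>set (tl c @ concat cs). hd c < y) \<and> led_by_minima cs"

text \<open>The remainder \<open>c\<close> of the cycle that is currently open, and the later cycles.\<close>

definition splittings :: "nat list \<Rightarrow> (nat list \<times> nat list list) set" where
  "splittings w = {(c, cs). c @ concat cs = w \<and> led_by_minima cs}"

lemma splittings_Nil: "splittings [] = {([], [])}"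
proof -
  have "cs = []" if "concat cs = []" "led_by_minima cs" for cs
    using that by (cases cs) auto
  then show ?thesis
    by (auto simp: splittings_def)
qed

text \<open>The letter \<open>b\<close> either continues the open cycle or, if it is a right-to-left
  minimum, opens the next one; in the latter case nothing is left of the open cycle.\<close>

lemma splittings_Cons:
  "splittings (b # w) = (\<lambda>(c, cs). (b # c, cs)) ` splittings w \<union>
     (if \<forall>y\<in>set w. b < y then (\<lambda>(c, cs). ([], (b # c) # cs)) ` splittings w else {})"
    (is "_ = ?R")
proof (intro equalityI subsetI)
  fix z assume z: "z \<in> splittings (b # w)"
  obtain c cs where zc: "z = (c, cs)"
    by (cases z)
  show "z \<in> ?R"
  proof (cases c)
    case (Cons x c')
    then show ?thesis
      using z zc by (auto simp: splittings_def image_iff)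
  next
    case Nil
    then obtain d ds where cs: "cs = d # ds"
      using z zc by (cases cs) (auto simp: splittings_def)
    then obtain d' where "d = b # d'"
      using z zc Nil by (cases d) (auto simp: splittings_def)
    then show ?thesis
      using z zc Nil cs by (auto simp: splittings_def image_iff)
  qed
qed (auto simp: splittings_def split: if_splits)

text \<open>Each right-to-left minimum doubles the count: the two families in
  \<open>splittings_Cons\<close> are told apart by whether the first component is empty.\<close>

lemma finite_card_splittings: "finite (splittings w) \<and> card (splittings w) = 2 ^ rlmin w"
proof (induction w)
  case Nil
  show ?case
    by (simp add: splittings_Nil)
next
  case (Cons b w)
  have inj: "inj (\<lambda>(c, cs). (b # c, cs))" "inj (\<lambda>(c, cs). ([], (b # c) # cs))"
    by (auto intro!: injI)
  have disj: "(\<lambda>(c, cs). (b # c, cs)) ` splittings w \<inter>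
      (\<lambda>(c, cs). ([], (b # c) # cs)) ` splittings w = {}"
    by auto
  show ?case
    using Cons disj
    by (auto simp: splittings_Cons card_Un_disjoint card_image inj_on_subset[OF inj(1)]
        inj_on_subset[OF inj(2)] simp del: Un_iff)
qed

lemma sum_permutations_of_set_Cons:
  fixes f :: "'a list \<Rightarrow> 'b::comm_monoid_add"
  assumes "finite S" "S \<noteq> {}"
  shows "(\<Sum>w\<in>permutations_of_set S. f w) =
    (\<Sum>b\<in>S. \<Sum>w\<in>permutations_of_set (S - {b}). f (b # w))"
  by (subst permutations_of_set_nonempty[OF assms(2)], subst sum.UNION_disjoint)
     (auto simp: assms sum.reindex inj_on_def)

text \<open>Sort by the first letter: \<open>Min S\<close> carries a factor 2 and every other letter
  a factor 1, so the value for \<open>S\<close> is \<open>card S + 1\<close> times that for one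
  letter fewer. This counts the cycle forms.\<close>

lemma sum_two_power_rlmin:
  "finite S \<Longrightarrow> (\<Sum>w\<in>permutations_of_set S. 2 ^ rlmin w) = (fact (Suc (card S)) :: nat)"
proof (induction "card S" arbitrary: S)
  case 0
  then show ?case by simp
next
  case (Suc m)
  then have ne: "S \<noteq> {}" by auto
  let ?c = "\<lambda>b. if b = Min S then 2 else (1::nat)"
  have min: "(\<forall>y\<in>S - {b}. b < y) \<longleftrightarrow> b = Min S" if "b \<in> S" for b
    using that Suc.prems by (auto simp: less_le Min_eq_iff[OF Suc.prems ne]
        intro!: Min_le eq_Min_iff[THEN iffD2] ne)
  have "(\<Sum>w\<in>permutations_of_set S. 2 ^ rlmin w) =
    (\<Sum>b\<in>S. ?c b * (\<Sum>w\<in>permutations_of_set (S - {b}). 2 ^ rlmin w))"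
    unfolding sum_permutations_of_set_Cons[OF Suc.prems ne] sum_distrib_left
    by (intro sum.cong refl) (auto simp: permutations_of_setD min)
  also have "\<dots> = (\<Sum>b\<in>S. ?c b * fact (Suc m))"
    using Suc by (intro sum.cong refl arg_cong2[of _ _ _ _ "(*)"]) (auto simp del: fact_Suc)
  also have "\<dots> = (\<Sum>b\<in>S. ?c b) * fact (Suc m)"
    by (simp add: sum_distrib_right)
  also have "(\<Sum>b\<in>S. ?c b) = Suc (card S)"
    using Suc.prems ne by (simp add: sum.If_cases card_Diff_subset Suc.hyps(2)[symmetric]
       sum.remove[OF Suc.prems Min_in[OF Suc.prems ne]])
  finally show ?case
    using Suc.hyps(2) by simp
qed

definition cycle_forms :: "nat \<Rightarrow> nat list list set" where
  "cycle_forms n = {cs. led_by_minima cs \<and> concat cs \<in> permutations_of_set {1..n}}"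

text \<open>The head of the first cycle lies below all other letters, hence is 1; deleting it leaves
  a word on \<open>{2..n}\<close> with a splitting.\<close>

lemma bij_betw_cycle_forms:
  assumes "n \<ge> 1"
  shows "bij_betw (\<lambda>(w, c, cs). (1 # c) # cs)
    (Sigma (permutations_of_set {2..n}) splittings) (cycle_forms n)" (is "bij_betw ?h ?A _")
proof (rule bij_betw_imageI)
  show "inj_on ?h ?A"
    by (auto simp: inj_on_def splittings_def)
  show "?h ` ?A = cycle_forms n"
  proof (intro equalityI subsetI)
    fix z assume "z \<in> ?h ` ?A"
    then show "z \<in> cycle_forms n"
      using assms by (fastforce simp: cycle_forms_def splittings_def permutations_of_set_def)
  next
    fix z assume z: "z \<in> cycle_forms n"
    then obtain d cs where "z = d # cs"
      using assms by (cases z) (auto simp: cycle_forms_def permutations_of_set_def)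
    then obtain x c where zc: "z = (x # c) # cs"
      using z by (cases d) (auto simp: cycle_forms_def)
    have less: "\<forall>y\<in>set c \<union> set (concat cs). x < y" and cs: "led_by_minima cs"
      and perm: "insert x (set (c @ concat cs)) = {1..n}" "distinct (x # c @ concat cs)"
      using z zc by (auto simp: cycle_forms_def permutations_of_set_def)
    have "1 \<in> insert x (set (c @ concat cs))"
      unfolding perm(1) using assms by simp
    moreover have "x \<in> {1..n}"
      unfolding perm(1)[symmetric] by simp
    ultimately have x: "x = 1"
      using less by force
    have "set (c @ concat cs) = {1..n} - {1}"
      using perm x by auto
    then have "c @ concat cs \<in> permutations_of_set {2..n}"
      using perm(2) by (auto simp: permutations_of_set_def)
    then have "(c @ concat cs, c, cs) \<in> ?A"
      using cs by (auto simp: splittings_def)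
    then show "z \<in> ?h ` ?A"
      unfolding zc x by (rule rev_image_eqI) simp
  qed
qed

lemma sum_cycle_forms:
  fixes f :: "nat list \<Rightarrow> 'a::comm_semiring_1"
  assumes "n \<ge> 1"
  shows "(\<Sum>cs\<in>cycle_forms n. f (concat cs)) =
    (\<Sum>w\<in>permutations_of_set {2..n}. 2 ^ rlmin w * f (1 # w))"
proof -
  have "(\<Sum>cs\<in>cycle_forms n. f (concat cs)) =
      (\<Sum>(w, c, cs)\<in>Sigma (permutations_of_set {2..n}) splittings. f (1 # w))"
    by (subst sum.reindex_bij_betw[OF bij_betw_cycle_forms[OF assms], symmetric])
       (auto intro!: sum.cong simp: splittings_def)
  also have "\<dots> = (\<Sum>w\<in>permutations_of_set {2..n}. \<Sum>z\<in>splittings w. f (1 # w))"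
    by (subst sum.Sigma) (auto simp: finite_card_splittings intro!: sum.cong)
  finally show ?thesis
    by (simp add: finite_card_splittings)
qed

section \<open>Standard cycle forms of permutations\<close>

lemma hd_support: "permutation p \<Longrightarrow> support p x \<noteq> [] \<and> hd (support p x) = x"
  using least_power_of_permutation(2)[of p x] by (simp add: hd_map)

lemma in_support_self: "permutation p \<Longrightarrow> x \<in> set (support p x)"
  using hd_support[of p x] by (metis hd_in_set)

text \<open>A point kept later in the list exceeds \<open>x\<close> and is least in its own cycle,
  so all letters of later cycles exceed \<open>x\<close>.\<close>

lemma led_by_minima_supports:
  assumes p: "permutation p" and "sorted_wrt (<) xs"
  shows "led_by_minima (map (support p) (filter (\<lambda>x. \<forall>y\<in>set (support p x). x \<le> y) xs))"
  using assms(2)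
proof (induction xs)
  case (Cons x xs)
  let ?P = "\<lambda>x. \<forall>y\<in>set (support p x). x \<le> y"
  have "x < y" if "?P x" "y \<in> set (tl (support p x))" for y
  proof -
    have "distinct (x # tl (support p x))" "y \<in> set (support p x)"
      using cycle_of_permutation[OF p, of x] hd_support[OF p, of x] that
      by (metis list.collapse, metis list.set_sel(2))
    then show ?thesis
      using that by (metis distinct.simps(2) le_neq_implies_less)
  qed
  moreover have "x < y" if "x' \<in> set xs" "?P x'" "y \<in> set (support p x')" for x' y
    using that Cons.prems by fastforce
  ultimately show ?case
    using Cons hd_support[OF p, of x] by (auto simp del: set_map simp: list.set_map)
qed simp

lemma standard_cycle_form_in_cycle_forms:
  assumes "p permutes {1..n}"
  shows "standard_cycle_form n p \<in> cycle_forms n"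
proof -
  have p: "permutation p"
    using assms permutation_permutes by blast
  let ?P = "\<lambda>x. \<forall>y\<in>set (support p x). x \<le> y"
  have sub: "set (support p x) \<subseteq> {1..n}" if "x \<in> {1..n}" for x
    using that permutes_in_image[OF permutes_funpow[OF assms]] by auto
  have same: "set (support p x) = set (support p y)" if "x \<in> set (support p y)" for x y
    using that disjoint_support[OF p] disjoint_support'[OF p, of x y]
    by (metis (no_types, lifting) disjointD rangeI)
  have "y \<in> set (flatten n p)" if y: "y \<in> {1..n}" for y
  proof -
    \<comment> \<open>The cycle of \<open>y\<close> is listed under its least element.\<close>
    define m where "m = Min (set (support p y))"
    have m: "m \<in> set (support p y)"
      unfolding m_def using in_support_self[OF p, of y] by (intro Min_in) auto
    have "?P m"
      unfolding same[OF m] by (simp add: m_def del: set_map)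
    moreover have "y \<in> set (support p m)"
      unfolding same[OF m] by (rule in_support_self[OF p])
    moreover have "m \<in> set [1..<Suc n]"
      using sub[OF y] m by auto
    ultimately show ?thesis
      unfolding flatten_def standard_cycle_form_def by auto
  qed
  moreover have "set (flatten n p) \<subseteq> {1..n}"
    using sub unfolding flatten_def standard_cycle_form_def by fastforce
  ultimately have set: "set (flatten n p) = {1..n}"
    by auto
  have "distinct (flatten n p)"
    unfolding flatten_def
  proof (rule distinct_concat)
    have "inj (support p)"
      using hd_support[OF p] by (intro injI) metis
    then show "distinct (standard_cycle_form n p)"
      by (auto simp: standard_cycle_form_def distinct_map simp del: upt_Suc intro: inj_on_subset)
    show "distinct ys" if "ys \<in> set (standard_cycle_form n p)" for ys
      using that cycle_of_permutation[OF p] by (auto simp: standard_cycle_form_def simp del: distinct_map)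
    show "set ys \<inter> set zs = {}" 
      if yz: "ys \<in> set (standard_cycle_form n p)" "zs \<in> set (standard_cycle_form n p)" "ys \<noteq> zs" for ys zs
    proof (rule ccontr)
      assume ne: "set ys \<inter> set zs \<noteq> {}"
      obtain x y where xy: "ys = support p x" "zs = support p y" "?P x" "?P y"
        using yz by (auto simp: standard_cycle_form_def)
      then have "set ys = set zs"
        using ne disjoint_support[OF p] by (metis (no_types, lifting) disjointD rangeI)
      then have "x = y"
        using xy in_support_self[OF p] by (metis le_antisym)
      then show False
        using xy yz by simp
    qed
  qed
  then show ?thesis
    using set led_by_minima_supports[OF p, of "[1..<Suc n]"]
    by (simp add: cycle_forms_def permutations_of_set_def flatten_def standard_cycle_form_def
        del: upt_Suc)
qed

text \<open>A list that is a \<open>support\<close> of both \<open>p\<close> and \<open>p'\<close>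
  determines the image of each of its letters under either.\<close>

lemma inj_on_standard_cycle_form: "inj_on (standard_cycle_form n) {p. p permutes {1..n}}"
proof (intro inj_onI ext, clarify)
  fix p p' x
  assume p: "p permutes {1..n}" and p': "p' permutes {1..n}"
    and eq: "standard_cycle_form n p = standard_cycle_form n p'"
  have perm: "permutation p" "permutation p'"
    using p p' permutation_permutes by blast+
  show "p x = p' x"
  proof (cases "x \<in> {1..n}")
    case True
    then have "x \<in> set (concat (standard_cycle_form n p))"
      using standard_cycle_form_in_cycle_forms[OF p]
      by (auto simp: cycle_forms_def permutations_of_set_def)
    then obtain c where c: "c \<in> set (standard_cycle_form n p)" "x \<in> set c"
      by auto
    then obtain a b where "c = support p a" "c = support p' b"
      using c(1) c(1)[unfolded eq] unfolding standard_cycle_form_def list.set_map by blast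
    then show ?thesis
      using cycle_restrict[OF perm(1), of x a] cycle_restrict[OF perm(2), of x b] c by simp
  next
    case False
    then show ?thesis
      using p p' by (simp add: permutes_def)
  qed
qed

text \<open>Surjectivity comes from counting: both sides have \<open>n!\<close> elements.\<close>

lemma bij_betw_standard_cycle_form:
  assumes "n \<ge> 1"
  shows "bij_betw (standard_cycle_form n) {p. p permutes {1..n}} (cycle_forms n)"
proof -
  have "card (cycle_forms n) = (\<Sum>cs\<in>cycle_forms n. 1)"
    by simp
  also have "\<dots> = fact (Suc (card {2..n}))"
    unfolding sum_cycle_forms[OF assms, of "\<lambda>_. 1"] by (simp add: sum_two_power_rlmin del: fact_Suc)
  also have "\<dots> = card {p. p permutes {1..n}}"
    using assms card_permutations[of "{1..n}" n] by (simp del: fact_Suc)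
  finally have card: "card (cycle_forms n) = card {p. p permutes {1..n}}" .
  moreover have "finite (cycle_forms n)"
    using card by (simp add: card_permutations card_ge_0_finite)
  moreover have "standard_cycle_form n ` {p. p permutes {1..n}} \<subseteq> cycle_forms n"
    using standard_cycle_form_in_cycle_forms by auto
  ultimately show ?thesis
    using inj_on_standard_cycle_form[of n]
    by (metis bij_betw_def card_image card_subset_eq)
qed

lemma sum_flatten:
  fixes f :: "nat list \<Rightarrow> 'a::comm_semiring_1"
  assumes "n \<ge> 1"
  shows "(\<Sum>p | p permutes {1..n}. f (flatten n p)) =
    (\<Sum>w\<in>permutations_of_set {2..n}. 2 ^ rlmin w * f (1 # w))"
  unfolding flatten_def
  using sum.reindex_bij_betw[OF bij_betw_standard_cycle_form[OF assms], of "\<lambda>cs. f (concat cs)"]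
    sum_cycle_forms[OF assms, of f] by simp

subsection \<open>Transfer recursion\<close>

lemma r123_two: "r123 [x, y] = 0"
  by (simp add: r123_def)

lemma r123_Cons_Cons_Cons:
  "r123 (x # y # z # w) = of_bool (x < y \<and> y < z) + r123 (y # z # w)"
proof -
  let ?P = "\<lambda>w i. i + 2 < length w \<and> w ! i < w ! (i + 1) \<and> w ! (i + 1) < w ! (i + (2::nat))"
  let ?A = "{i. ?P (y # z # w) i}"
  have "{i. ?P (x # y # z # w) i} = (if x < y \<and> y < z then {0} else {}) \<union> Suc ` ?A" (is "?L = ?R")
  proof (rule set_eqI)
    fix i
    show "i \<in> ?L \<longleftrightarrow> i \<in> ?R"
      by (cases i) (auto simp: image_iff)
  qed
  moreover have "finite ?A"
    by (rule finite_subset[of _ "{..<length (y # z # w)}"]) auto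
  ultimately show ?thesis
    unfolding r123_def by (simp add: card_insert_if card_image)
qed

text \<open>The letter \<open>a\<close> may lie outside \<open>S\<close>: the same function measures
  the current letter against the remaining ones and numbers the remaining ones from 0.\<close>

definition rank :: "nat set \<Rightarrow> nat \<Rightarrow> nat" where
  "rank S a = card {s\<in>S. s < a}"

lemma rank_less_iff:
  assumes "finite S" "b \<in> S"
  shows "rank S b < rank S a \<longleftrightarrow> b < a"
proof (cases "b < a")
  case True
  then have "{s\<in>S. s < b} \<subset> {s\<in>S. s < a}"
    using assms by force
  then show ?thesis
    using True assms by (simp add: rank_def psubset_card_mono)
next
  case False
  then have "{s\<in>S. s < a} \<subseteq> {s\<in>S. s < b}"
    by auto
  then show ?thesis
    using False assms by (simp add: rank_def card_mono not_less)
qed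

lemma bij_betw_rank:
  assumes "finite S"
  shows "bij_betw (rank S) S {..<card S}"
proof -
  have inj: "inj_on (rank S) S"
    using rank_less_iff[OF assms] by (metis inj_onI nat_neq_iff)
  have "rank S b < card S" if "b \<in> S" for b
    unfolding rank_def using that assms by (intro psubset_card_mono) auto
  then have "rank S ` S \<subseteq> {..<card S}"
    by auto
  then show ?thesis
    using inj by (simp add: bij_betw_def card_image card_subset_eq)
qed

definition qvar :: "rat poly" where
  "qvar = [:0, 1:]"

text \<open>The total weight of the continuations of a word depends only on the number \<open>n\<close> of
  letters still to come, the number \<open>m\<close> of those that are smaller than the current last letter,
  and whether that letter was reached by an ascent.\<close>

definition min_wt :: "nat \<Rightarrow> rat poly" where
  "min_wt m = (if m = 0 then 2 else 1)"

text \<open>The index \<open>j\<close> is the rank of the next letter: a descent for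
  \<open>j < m\<close>, otherwise an ascent, which completes a 123-subword if the last step was an
  ascent too. The factor \<open>min_wt m\<close> doubles the weight when the current letter is a
  right-to-left minimum.\<close>

fun after_descent :: "nat \<Rightarrow> nat \<Rightarrow> rat poly" and after_ascent :: "nat \<Rightarrow> nat \<Rightarrow> rat poly" where
  "after_descent 0 m = min_wt m"
| "after_descent (Suc n) m =
     min_wt m * ((\<Sum>j<m. after_descent n j) + (\<Sum>j=m..n. after_ascent n j))"
| "after_ascent 0 m = min_wt m"
| "after_ascent (Suc n) m =
     min_wt m * ((\<Sum>j<m. after_descent n j) + qvar * (\<Sum>j=m..n. after_ascent n j))"

text \<open>Induction on the number of remaining letters, choosing the next letter \<open>b\<close>;
  the sum over \<open>b\<close> becomes a sum over ranks by \<open>bij_betw_rank\<close>.\<close>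

lemma sum_continuations:
  assumes "finite S" "a \<notin> S" "x \<noteq> a"
  shows "(\<Sum>w\<in>permutations_of_set S. 2 ^ rlmin (a # w) * qvar ^ r123 (x # a # w)) =
    (if x < a then after_ascent else after_descent) (card S) (rank S a)"
  using assms
proof (induction "card S" arbitrary: S a x)
  case 0
  then show ?case
    by (simp add: rank_def min_wt_def r123_two)
next
  case (Suc n)
  let ?wt = "\<lambda>x a w. 2 ^ rlmin (a # w) * qvar ^ r123 (x # a # w) :: rat poly"
  let ?q = "\<lambda>m j. if x < a \<and> m \<le> j then qvar else 1 :: rat poly"
  let ?f = "\<lambda>j. if j < rank S a then after_descent n j
                else ?q (rank S a) j * after_ascent n j"
  have ne: "S \<noteq> {}" and m: "rank S a \<le> Suc n"
    using Suc by (auto simp: rank_def card_mono)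
  have min: "(\<forall>y\<in>S. a < y) \<longleftrightarrow> rank S a = 0"
    using Suc.prems by (auto simp: rank_def not_less) (metis le_neq_implies_less)
  have "(\<Sum>w\<in>permutations_of_set S. ?wt x a w) =
      min_wt (rank S a) * (\<Sum>b\<in>S. ?f (rank S b))"
    unfolding sum_permutations_of_set_Cons[OF Suc.prems(1) ne] sum_distrib_left
  proof (rule sum.cong[OF refl])
    fix b assume b: "b \<in> S"
    then have ab: "a \<noteq> b"
      using Suc.prems by auto
    \<comment> \<open>Removing \<open>b\<close> keeps all letters below it, so its rank passes
      unchanged to the next stage.\<close>
    have rank: "rank (S - {b}) b = rank S b"
      unfolding rank_def by (rule arg_cong[of _ _ card]) auto
    have min_b: "(\<forall>y\<in>insert b (S - {b}). a < y) \<longleftrightarrow> rank S a = 0"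
      using min b by (simp add: insert_absorb)
    have "(\<Sum>w\<in>permutations_of_set (S - {b}). ?wt x a (b # w)) =
        (\<Sum>w\<in>permutations_of_set (S - {b}). min_wt (rank S a) *
          (if x < a \<and> a < b then qvar else 1) * ?wt a b w)"
    proof (rule sum.cong[OF refl])
      fix w assume "w \<in> permutations_of_set (S - {b})"
      then have "set (b # w) = insert b (S - {b})"
        by (simp add: permutations_of_setD)
      then have "rlmin (a # b # w) = (if rank S a = 0 then 1 else 0) + rlmin (b # w)"
        using min_b by (simp del: insert_Diff_single)
      then show "?wt x a (b # w) = min_wt (rank S a) *
          (if x < a \<and> a < b then qvar else 1) * ?wt a b w"
        by (simp add: r123_Cons_Cons_Cons min_wt_def del: rlmin.simps)
    qed
    also have "\<dots> = min_wt (rank S a) * ((if x < a \<and> a < b then qvar else 1) *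
        (if a < b then after_ascent else after_descent) n (rank S b))"
      unfolding sum_distrib_left[symmetric] mult.assoc
      using Suc.hyps(1)[of "S - {b}" b a] Suc.hyps(2)[symmetric] Suc.prems b ab rank
      by (simp del: rlmin.simps)
    also have "\<dots> = min_wt (rank S a) * ?f (rank S b)"
      using rank_less_iff[OF Suc.prems(1) b, of a] ab by auto
    finally show "(\<Sum>w\<in>permutations_of_set (S - {b}). ?wt x a (b # w)) =
      min_wt (rank S a) * ?f (rank S b)" .
  qed
  also have "(\<Sum>b\<in>S. ?f (rank S b)) = (\<Sum>j<Suc n. ?f j)"
    using sum.reindex_bij_betw[OF bij_betw_rank[OF Suc.prems(1)], of ?f] Suc.hyps(2) by simp
  also have "\<dots> = (\<Sum>j<rank S a. ?f j) + (\<Sum>j=rank S a..n. ?f j)"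
  proof -
    have "{..<Suc n} = {..<rank S a} \<union> {rank S a..n}"
      using m by auto
    then show ?thesis
      by (metis (no_types, lifting) finite_atLeastAtMost finite_lessThan ivl_disj_int_one(4)
          sum.union_disjoint)
  qed
  also have "\<dots> = (\<Sum>j<rank S a. after_descent n j) +
      (if x < a then qvar else 1) * (\<Sum>j=rank S a..n. after_ascent n j)"
    by (auto simp: sum_distrib_left intro!: arg_cong2[of _ _ _ _ "(+)"] sum.cong)
  finally show ?case
    using Suc.hyps(2)[symmetric] by auto
qed

lemma sum_one_Cons:
  assumes "2 \<le> k" "k \<le> n"
  shows "(\<Sum>w\<in>permutations_of_set ({2..n} - {k}).
      2 ^ rlmin (k # w) * qvar ^ r123 (1 # k # w)) = after_ascent (n - 2) (k - 2)"
proof -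
  have "{s \<in> {2..n} - {k}. s < k} = {2..<k}"
    using assms by auto
  then show ?thesis
    using sum_continuations[of "{2..n} - {k}" k 1] assms
    by (simp add: rank_def numeral_2_eq_2 del: rlmin.simps)
qed

lemma gr_word_one_Cons:
  assumes "2 \<le> k" "k \<le> n"
  shows "gr_word n [1, k] = after_ascent (n - 2) (k - 2)"
proof -
  let ?q = "qvar"
  have ne: "{2..n} \<noteq> {}" "n \<ge> 1"
    using assms by auto
  have "gr_word n [1, k] = (\<Sum>p | p permutes {1..n}.
      if prefix [1, k] (flatten n p) then ?q ^ r123 (flatten n p) else 0)"
    unfolding gr_word_def qvar_def by (rule sum.mono_neutral_cong_left) (auto simp: finite_permutations)
  also have "\<dots> = (\<Sum>w\<in>permutations_of_set {2..n}. 2 ^ rlmin w *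
      (if prefix [1, k] (1 # w) then ?q ^ r123 (1 # w) else 0))"
    by (rule sum_flatten) (use ne in simp)
  also have "\<dots> = (\<Sum>b\<in>{2..n}. if b = k then (\<Sum>w\<in>permutations_of_set ({2..n} - {k}).
      2 ^ rlmin (k # w) * ?q ^ r123 (1 # k # w)) else 0)"
    unfolding sum_permutations_of_set_Cons[OF finite_atLeastAtMost ne(1)]
    by (intro sum.cong refl) auto
  finally show ?thesis
    using sum_one_Cons[OF assms] assms by simp
qed

lemma gr_eq_sum: "gr (n + 2) = (\<Sum>j\<le>n. after_ascent n j)"
proof -
  have "gr (n + 2) = (\<Sum>w\<in>permutations_of_set {2..n + 2}. 2 ^ rlmin w * qvar ^ r123 (1 # w))"
    unfolding gr_def qvar_def by (rule sum_flatten) simp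
  also have "\<dots> = (\<Sum>b\<in>{2..n + 2}. after_ascent n (b - 2))"
    by (subst sum_permutations_of_set_Cons) (use sum_one_Cons[of _ "n + 2"] in \<open>auto intro!: sum.cong\<close>)
  also have "\<dots> = (\<Sum>j\<le>n. after_ascent n j)"
    by (rule sum.reindex_bij_witness[of _ "\<lambda>j. j + 2" "\<lambda>b. b - 2"]) auto
  finally show ?thesis .
qed

subsection \<open>Second-order recurrences\<close>

abbreviation theta :: "rat poly" where
  "theta \<equiv> 1 - qvar"

text \<open>From rank 0 every next step is an ascent, which gives the full sum of
  \<open>gr_eq_sum\<close>.\<close>

lemma after_descent_0: "after_descent (Suc n) 0 = 2 * gr (n + 2)"
  unfolding gr_eq_sum by (simp add: min_wt_def atLeast0AtMost)

lemma after_ascent_0: "after_ascent (Suc n) 0 = 2 * qvar * gr (n + 2)"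
  unfolding gr_eq_sum by (simp add: min_wt_def atLeast0AtMost)

text \<open>This differs from the full sum for \<open>gr (n + 3)\<close> only at
  \<open>j = 0\<close>, where a descent replaces an ascent.\<close>

lemma after_descent_1: "after_descent (Suc (Suc n)) 1 = gr (n + 3) + 2 * theta * gr (n + 2)"
proof -
  have "gr (n + 3) = (\<Sum>j\<le>Suc n. after_ascent (Suc n) j)"
    using gr_eq_sum[of "Suc n"] by (simp add: numeral_3_eq_3)
  also have "\<dots> = after_ascent (Suc n) 0 + (\<Sum>j=1..Suc n. after_ascent (Suc n) j)"
    unfolding atLeast0AtMost[symmetric] by (subst sum.atLeast_Suc_atMost) simp_all
  finally have "after_descent (Suc (Suc n)) 1 =
      after_descent (Suc n) 0 + (gr (n + 3) - after_ascent (Suc n) 0)"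
    unfolding after_descent.simps(2)[of "Suc n" 1]
    by (simp add: min_wt_def del: after_descent.simps after_ascent.simps)
  then show ?thesis
    unfolding after_descent_0 after_ascent_0 by (simp add: algebra_simps)
qed

text \<open>Raising \<open>m\<close> turns the term \<open>j = m\<close> from an ascent into a
  descent; \<open>min_wt\<close> is 1 throughout.\<close>

lemma after_descent_Suc:
  assumes "1 \<le> m" "m \<le> n"
  shows "after_descent (Suc n) (Suc m) =
    after_descent (Suc n) m + after_descent n m - after_ascent n m"
  unfolding after_descent.simps(2) using assms
  by (simp add: min_wt_def sum.atLeast_Suc_atMost[of m n] del: after_descent.simps after_ascent.simps)

lemma after_ascent_eq:
  assumes "1 \<le> m"
  shows "after_ascent (Suc n) m =
    qvar * after_descent (Suc n) m + theta * (\<Sum>j<m. after_descent n j)"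
  unfolding after_descent.simps(2) after_ascent.simps(2) using assms
  by (simp add: min_wt_def algebra_simps del: after_descent.simps after_ascent.simps)

lemma after_ascent_Suc:
  assumes "1 \<le> m" "m \<le> n"
  shows "after_ascent (Suc n) (Suc m) =
    after_ascent (Suc n) m - qvar * after_ascent n m + after_descent n m"
  using assms unfolding after_ascent_eq[OF assms(1)] after_ascent_eq[OF le_SucI[OF assms(1)]]
    after_descent_Suc[OF assms]
  by (simp add: algebra_simps del: after_descent.simps after_ascent.simps)

text \<open>Solving \<open>after_ascent_Suc\<close> for the descent values at \<open>n + 1\<close>
  and \<open>n\<close> and inserting them into \<open>after_descent_Suc\<close> leaves only ascent
  values.\<close>

lemma after_ascent_recurrence:
  assumes "1 \<le> m" "m \<le> n"
  shows "after_ascent (n + 2) (m + 2) =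
    2 * after_ascent (n + 2) (m + 1) - after_ascent (n + 2) m
    + theta * (after_ascent (n + 1) (m + 1) - after_ascent (n + 1) m) - theta * after_ascent n m"
proof -
  have asc: "after_ascent (n + 2) (m + 2) = after_ascent (n + 2) (m + 1)
      - qvar * after_ascent (n + 1) (m + 1) + after_descent (n + 1) (m + 1)"
    using after_ascent_Suc[of "m + 1" "n + 1"] assms by simp
  have desc: "after_descent (n + 1) (m + 1) =
      after_descent (n + 1) m + after_descent n m - after_ascent n m"
    using after_descent_Suc[OF assms] by simp
  have desc_n1: "after_descent (n + 1) m =
      after_ascent (n + 2) (m + 1) - after_ascent (n + 2) m + qvar * after_ascent (n + 1) m"
    using after_ascent_Suc[of m "n + 1"] assms
    by (simp del: after_descent.simps after_ascent.simps)
  have desc_n: "after_descent n m =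
      after_ascent (n + 1) (m + 1) - after_ascent (n + 1) m + qvar * after_ascent n m"
    using after_ascent_Suc[OF assms] by (simp del: after_descent.simps after_ascent.simps)
  show ?thesis
    unfolding asc desc desc_n1 desc_n
    by (simp add: algebra_simps del: after_descent.simps after_ascent.simps)
qed

text \<open>Initial value for \<open>k = 3\<close>; \<open>after_ascent_2\<close> is the one for
  \<open>k = 4\<close>.\<close>

lemma after_ascent_1:
  "after_ascent (n + 2) 1 =
    qvar * gr (n + 3) + 2 * theta * (1 + qvar) * gr (n + 2)"
proof -
  have "after_ascent (n + 2) 1 =
      qvar * after_descent (Suc (Suc n)) 1 + theta * after_descent (Suc n) 0"
    using after_ascent_eq[of 1 "Suc n"] by (simp del: after_descent.simps after_ascent.simps)
  then show ?thesis
    unfolding after_descent_1 after_descent_0 by (simp add: algebra_simps)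
qed

lemma after_ascent_2:
  "after_ascent (n + 3) 2 = after_ascent (n + 3) 1 - qvar * after_ascent (n + 2) 1
    + gr (n + 3) + 2 * theta * gr (n + 2)"
  using after_ascent_Suc[of 1 "n + 2"] after_descent_1[of n]
  by (simp add: numeral_2_eq_2 numeral_3_eq_3 del: after_descent.simps after_ascent.simps)

text \<open>The \<open>br\<close> without the square root: they satisfy a recurrence over \<open>\<rat>[q]\<close>, which extends
  down to \<open>i = 0\<close> with the value \<open>-1\<close>. The value at \<open>0\<close> differs from \<open>br 0\<close>, where the
  exponent \<open>i - 1\<close> is truncated.\<close>

fun beta :: "nat \<Rightarrow> rat poly" where
  "beta 0 = -1"
| "beta (Suc 0) = qvar"
| "beta (Suc (Suc i)) = theta * (beta (Suc i) - beta i)"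

section \<open>The right-hand side of the theorem over \<rat>[q]\<close>

lemma alpha_0: "1 \<le> m \<Longrightarrow> alpha (m + 2) 0 = 0"
  by (simp add: alpha_def binom_def)

text \<open>Pascal's rule for both binomials; it holds for every integer lower index because
  \<open>binom\<close> vanishes at negative ones.\<close>

lemma alpha_Suc:
  assumes "1 \<le> m"
  shows "alpha (Suc m + 2) (Suc i) = alpha (m + 2) (Suc i) + alpha (m + 2) i"
proof -
  have pascal: "binom (Suc a) j = binom a j + binom a (j - 1)" for a j
    by (cases "nat j") (auto simp: binom_def nat_diff_distrib)
  have "m + 2 = Suc (m + 1)" "m = Suc (m - 1)"
    using assms by auto
  then show ?thesis
    unfolding alpha_def using pascal[of "m + 1" "int i"] pascal[of "m - 1" "int i - 2"]
    by simp
qed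

text \<open>At \<open>i = m + 2\<close> both binomials are 1 and cancel; beyond that both
  vanish.\<close>

lemma alpha_eq_0:
  assumes "1 \<le> m" "m + 1 < i"
  shows "alpha (m + 2) i = 0"
proof -
  have "nat (int i - 1) = i - 1" "nat (int i - 3) = i - 3"
    by auto
  then have "alpha (m + 2) i = int ((m + 1) choose (i - 1)) - int ((m - 1) choose (i - 3))"
    using assms by (auto simp: alpha_def binom_def)
  moreover have "(m + 1) choose (i - 1) = (m - 1) choose (i - 3)"
    using assms by (cases "i = m + 2") (auto simp: binomial_eq_0)
  ultimately show ?thesis
    by simp
qed

text \<open>The right-hand side for length \<open>n + 2\<close> and \<open>k = m + 2\<close>. The
  range does not depend on \<open>m\<close>, so differences in \<open>m\<close> can be taken
  termwise.\<close>

definition alpha_beta_sum :: "nat \<Rightarrow> nat \<Rightarrow> rat poly" where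
  "alpha_beta_sum n m = (\<Sum>i\<le>n. of_int (alpha (m + 2) i) * beta i * gr (n + 2 - i))"

lemma alpha_beta_sum_Suc:
  assumes "1 \<le> m"
  shows "alpha_beta_sum (Suc n) (Suc m) = alpha_beta_sum (Suc n) m +
    (\<Sum>i\<le>n. of_int (alpha (m + 2) i) * beta (Suc i) * gr (n + 2 - i))"
  unfolding alpha_beta_sum_def using alpha_0[of m] alpha_0[of "Suc m"] alpha_Suc[OF assms] assms
  by (simp add: sum.atMost_Suc_shift sum.distrib[symmetric] algebra_simps del: sum.atMost_Suc)

text \<open>Each difference in \<open>m\<close> shifts the index of \<open>beta\<close> up by one
  against that of \<open>alpha\<close>; after two of them the recurrence of \<open>beta\<close>
  applies.\<close>

lemma alpha_beta_sum_recurrence: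
  assumes "1 \<le> m"
  shows "alpha_beta_sum (n + 2) (m + 2) = 2 * alpha_beta_sum (n + 2) (m + 1) - alpha_beta_sum (n + 2) m
    + theta * (alpha_beta_sum (n + 1) (m + 1) - alpha_beta_sum (n + 1) m) - theta * alpha_beta_sum n m"
proof -
  let ?t = "\<lambda>i j. of_int (alpha (m + 2) i) * beta j * gr (n + 2 - i)"
  have "alpha_beta_sum (n + 2) (m + 2) - alpha_beta_sum (n + 2) (m + 1)
      - (alpha_beta_sum (n + 2) (m + 1) - alpha_beta_sum (n + 2) m) =
     (\<Sum>i\<le>Suc n. (of_int (alpha (m + 3) i) - of_int (alpha (m + 2) i)) * beta (Suc i) * gr (n + 3 - i))"
    using alpha_beta_sum_Suc[of "Suc m" "Suc n"] alpha_beta_sum_Suc[of m "Suc n"] assms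
    by (simp add: sum_subtractf left_diff_distrib numeral_3_eq_3 del: sum.atMost_Suc beta.simps)
  \<comment> \<open>Pascal's rule again; the term \<open>i = 0\<close> drops out by
    \<open>alpha_0\<close>.\<close>
  also have "\<dots> = (\<Sum>i\<le>n. ?t i (Suc (Suc i)))"
    using alpha_0[of m] alpha_0[of "Suc m"] alpha_Suc[OF assms] assms
    by (simp add: sum.atMost_Suc_shift numeral_3_eq_3 del: sum.atMost_Suc beta.simps)
  also have "\<dots> = theta * ((\<Sum>i\<le>n. ?t i (Suc i)) - (\<Sum>i\<le>n. ?t i i))"
    unfolding sum_subtractf[symmetric] sum_distrib_left
    by (rule sum.cong[OF refl]) (simp add: algebra_simps)
  also have "\<dots> = theta * ((alpha_beta_sum (n + 1) (m + 1) - alpha_beta_sum (n + 1) m) - alpha_beta_sum n m)"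
    using alpha_beta_sum_Suc[OF assms, of n] by (simp add: alpha_beta_sum_def)
  finally show ?thesis
    by (simp add: algebra_simps)
qed

text \<open>Only \<open>alpha 3 1 = 1\<close> and \<open>alpha 3 2 = 2\<close> are nonzero.\<close>

lemma alpha_beta_sum_1: "alpha_beta_sum (n + 2) 1 = qvar * gr (n + 3) + 2 * theta * (1 + qvar) * gr (n + 2)"
proof -
  have "alpha_beta_sum (n + 2) 1 = (\<Sum>i\<in>{1, 2}. of_int (alpha 3 i) * beta i * gr (n + 4 - i))"
    unfolding alpha_beta_sum_def
  proof (rule sum.mono_neutral_cong_right)
    show "\<forall>i\<in>{..n + 2} - {1, 2}. of_int (alpha (1 + 2) i) * beta i * gr (n + 2 + 2 - i) = 0"
      using alpha_0[of 1] alpha_eq_0[of 1]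
      by (metis (no_types, lifting) DiffD2 insertCI le_eq_less_or_eq less_one mult_zero_left
          not_less numeral_2_eq_2 of_int_0 one_add_one One_nat_def Suc_leI)
  qed (auto simp: numeral_3_eq_3)
  also have "\<dots> = qvar * gr (n + 3) + 2 * theta * (1 + qvar) * gr (n + 2)"
    by (simp add: alpha_def binom_def numeral_2_eq_2 numeral_3_eq_3 algebra_simps)
  finally show ?thesis .
qed

text \<open>The form of \<open>after_ascent_2\<close>. It rests on
  \<open>beta 2 = 1 - qvar ^ 2\<close> and
  \<open>beta 3 = theta * (1 - qvar - qvar ^ 2)\<close>.\<close>

lemma alpha_beta_sum_2:
  "alpha_beta_sum (n + 3) 2 = alpha_beta_sum (n + 3) 1 - qvar * alpha_beta_sum (n + 2) 1
    + gr (n + 3) + 2 * theta * gr (n + 2)"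
proof -
  have "(\<Sum>i\<le>n + 2. of_int (alpha 3 i) * beta (Suc i) * gr (n + 4 - i)) =
      (\<Sum>i\<in>{1, 2}. of_int (alpha 3 i) * beta (Suc i) * gr (n + 4 - i))"
  proof (rule sum.mono_neutral_right)
    show "\<forall>i\<in>{..n + 2} - {1, 2}. of_int (alpha 3 i) * beta (Suc i) * gr (n + 4 - i) = 0"
      using alpha_0[of 1] alpha_eq_0[of 1]
      by (auto simp: numeral_3_eq_3) (metis Suc_lessI gr0I numeral_2_eq_2)
  qed auto
  moreover have "alpha_beta_sum (n + 3) 2 = alpha_beta_sum (n + 3) 1 +
      (\<Sum>i\<le>n + 2. of_int (alpha 3 i) * beta (Suc i) * gr (n + 4 - i))"
    using alpha_beta_sum_Suc[of 1 "n + 2"] by (simp add: eval_nat_numeral del: sum.atMost_Suc beta.simps)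
  ultimately have "alpha_beta_sum (n + 3) 2 = alpha_beta_sum (n + 3) 1 +
      (\<Sum>i\<in>{1, 2}. of_int (alpha 3 i) * beta (Suc i) * gr (n + 4 - i))"
    by (simp only:)
  then show ?thesis
    unfolding alpha_beta_sum_1
    by (simp add: alpha_def binom_def numeral_2_eq_2 numeral_3_eq_3 algebra_simps)
qed

lemma after_ascent_eq_alpha_beta_sum: "1 \<le> m \<Longrightarrow> m < n \<Longrightarrow> after_ascent n m = alpha_beta_sum n m"
proof (induction m arbitrary: n rule: less_induct)
  case (less m)
  consider "m = 1" | "m = 2" | "3 \<le> m"
    using less.prems by linarith
  then show ?case
  proof cases
    case 1
    then obtain k where "n = k + 2"
      using less.prems by (metis add.commute le_Suc_ex Suc_leI one_add_one plus_1_eq_Suc)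
    then show ?thesis
      using 1 after_ascent_1 alpha_beta_sum_1 by metis
  next
    case 2
    then obtain k where n: "n = k + 3"
      using less.prems by (metis add.commute le_Suc_ex Suc_leI numeral_2_eq_2 numeral_3_eq_3)
    show ?thesis
      unfolding n 2 after_ascent_2 alpha_beta_sum_2 using after_ascent_1[of k] alpha_beta_sum_1[of k]
        after_ascent_1[of "Suc k"] alpha_beta_sum_1[of "Suc k"]
      by (simp add: numeral_2_eq_2 numeral_3_eq_3 del: after_ascent.simps)
  next
    case 3
    \<comment> \<open>The recurrence at \<open>(l, k)\<close> refers to five pairs, each with
      smaller second index and again within the range of the claim.\<close>
    define k l where "k = m - 2" and "l = n - 2"
    then have kl: "m = k + 2" "n = l + 2" "1 \<le> k" "k < l"
      using 3 less.prems by auto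
    have "after_ascent (l + 2) (k + 1) = alpha_beta_sum (l + 2) (k + 1)"
      "after_ascent (l + 2) k = alpha_beta_sum (l + 2) k"
      "after_ascent (l + 1) (k + 1) = alpha_beta_sum (l + 1) (k + 1)"
      "after_ascent (l + 1) k = alpha_beta_sum (l + 1) k"
      "after_ascent l k = alpha_beta_sum l k"
      using kl by (auto intro!: less.IH simp del: after_ascent.simps)
    then show ?thesis
      using kl by (simp only: after_ascent_recurrence[of k l] alpha_beta_sum_recurrence[of k l] less_imp_le)
  qed
qed

section \<open>Chebyshev polynomials and the square root of \<theta>\<close>

lemma adjoin_sqrt_arith:
  "adjoin_sqrt 0 = 0" "adjoin_sqrt 1 = 1"
  "adjoin_sqrt (p + r) = adjoin_sqrt p + adjoin_sqrt r"
  "adjoin_sqrt (p - r) = adjoin_sqrt p - adjoin_sqrt r"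
  "adjoin_sqrt (p * r) = adjoin_sqrt p * adjoin_sqrt r"
  "adjoin_sqrt (of_int c) = of_int c"
  "adjoin_sqrt (sum f A) = (\<Sum>x\<in>A. adjoin_sqrt (f x))"
  by (simp_all add: adjoin_sqrt_def pcompose_add pcompose_diff pcompose_mult pcompose_1
      pcompose_sum of_int_poly pcompose_const)

lemma cheb_U_half_sqrt_theta:
  assumes "0 \<le> m"
  shows "cheb_U m (smult (1/2) sqrt_theta) = sqrt_theta * cheb_U (m - 1) (smult (1/2) sqrt_theta)
    - cheb_U (m - 2) (smult (1/2) sqrt_theta)"
proof -
  have "2 * smult (1/2) sqrt_theta = sqrt_theta"
    by (simp add: sqrt_theta_def numeral_poly)
  then show ?thesis
    using assms by (subst cheb_U.simps) simp
qed

lemma cheb_U_neg: "cheb_U (-1) t = 0" "cheb_U (-2) t = -1"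
  by (simp_all add: cheb_U.simps)

lemma br_1: "br 1 = 1 - sqrt_theta ^ 2"
  by (simp add: br_def cheb_U_half_sqrt_theta cheb_U_neg power2_eq_square)

lemma br_2: "br 2 = sqrt_theta ^ 2 * (2 - sqrt_theta ^ 2)"
  by (simp add: br_def cheb_U_half_sqrt_theta cheb_U_neg power2_eq_square algebra_simps)

text \<open>The Chebyshev recurrence at half of \<open>sqrt_theta\<close>, where
  \<open>2 * t\<close> becomes \<open>sqrt_theta\<close>. It starts at index 3, so that no exponent
  in \<open>br\<close> is truncated.\<close>

lemma br_recurrence: "br (i + 3) = sqrt_theta ^ 2 * (br (i + 2) - br (i + 1))"
proof -
  let ?U = "\<lambda>m. cheb_U m (smult (1/2) sqrt_theta)"
  have U: "?U (int (i + 3) + 1) = sqrt_theta * ?U (int (i + 2) + 1) - ?U (int (i + 1) + 1)"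
    using cheb_U_half_sqrt_theta[of "int (i + 3) + 1"] by (simp add: algebra_simps)
  show ?thesis
    unfolding br_def U by (simp add: algebra_simps power2_eq_square)
qed

lemma adjoin_sqrt_beta: "1 \<le> i \<Longrightarrow> adjoin_sqrt (beta i) = br i"
proof (induction i rule: beta.induct)
  case 2
  then show ?case
    using sqrt_theta_squared[folded qvar_def] br_1 by (simp add: adjoin_sqrt_arith)
next
  case (3 i)
  show ?case
  proof (cases i)
    case 0
    \<comment> \<open>Here the recurrence uses \<open>beta 0 = -1\<close>, which is not the image of
      \<open>br 0\<close>, so \<open>br_2\<close> is compared directly.\<close>
    have "adjoin_sqrt (beta 2) = adjoin_sqrt theta * (1 + (1 - adjoin_sqrt theta))"
      by (simp add: numeral_2_eq_2 adjoin_sqrt_arith del: One_nat_def)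
    then show ?thesis
      using 0 br_2 sqrt_theta_squared[folded qvar_def] by (simp add: numeral_2_eq_2)
  next
    case (Suc j)
    then show ?thesis
      using 3 br_recurrence[of j] sqrt_theta_squared[folded qvar_def]
      by (simp add: adjoin_sqrt_arith numeral_2_eq_2 numeral_3_eq_3)
  qed
qed simp

theorem theorem3p3:
  fixes n k :: nat
  assumes "3 \<le> k" and "k \<le> n - 1"
  shows "adjoin_sqrt (gr_word n [1, k]) =
    (\<Sum>i = 1..k - 1. of_int (alpha k i) * br i * adjoin_sqrt (gr (n - i)))"
proof -
  define m where "m = k - 2"
  have m: "1 \<le> m" "m < n - 2" and k: "k = m + 2" and n: "n - 2 + 2 = n"
    using assms by (auto simp: m_def)
  have "gr_word n [1, k] = alpha_beta_sum (n - 2) m"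
    using gr_word_one_Cons[of k n] after_ascent_eq_alpha_beta_sum[OF m] assms by (simp add: m_def)
  also have "\<dots> = (\<Sum>i = 1..k - 1. of_int (alpha k i) * beta i * gr (n - i))"
    unfolding alpha_beta_sum_def n k
  \<comment> \<open>The additional terms, at \<open>i = 0\<close> and at \<open>i > k - 1\<close>,
    vanish because \<open>alpha\<close> does.\<close>
  proof (rule sum.mono_neutral_right)
    show "\<forall>i\<in>{..n - 2} - {1..m + 2 - 1}. of_int (alpha (m + 2) i) * beta i * gr (n - i) = 0"
    proof
      fix i assume "i \<in> {..n - 2} - {1..m + 2 - 1}"
      then have "i = 0 \<or> m + 1 < i"
        by auto
      then have "alpha (m + 2) i = 0"
        using alpha_0[OF m(1)] alpha_eq_0[OF m(1)] by blast
      then show "of_int (alpha (m + 2) i) * beta i * gr (n - i) = 0"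
        by simp
    qed
  qed (use m in auto)
  finally show ?thesis
    by (simp add: adjoin_sqrt_arith adjoin_sqrt_beta)
qed

end
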